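(* (Free Pólya's Theorem) Let $p\in\mathbb{C}\langle z_1,\ldots,z_d\rangle$ with $m:=\deg(p)$. Then the following are equivalent: (i) All coefficients of $p$ are nonnegative reals. (ii) For all $A_1,\ldots,A_d\in\mathrm{Mat}_{m+1}(\mathbb{Z}_{\geqslant 0})$ we have $p(A_1,\ldots,A_d)\in\mathrm{Mat}_{m+1}(\mathbb{R}_{\geqslant 0})$. In particular, $\mathcal{P}_{\mathrm{coeff}}=\mathcal{P}_{\mathrm{eval}}$, and in the definition of $\mathcal{P}_{\mathrm{eval}}$ one can restrict $\ell$ to $\deg(p)+1$, that is, a polynomial $p\in\mathbb{Z}\langle z_1,\ldots,z_d\rangle$ belongs to $\mathcal{P}_{\mathrm{eval}}$ if and only if $p(A_1,\ldots,A_d)\in\mathrm{Mat}_{\deg(p)+1}(\mathbb{Z}_{\geqslant 0})$ for all $A_1,\ldots,A_d\in\mathrm{Mat}_{\deg(p)+1}(\mathbb{Z}_{\geqslant 0})$.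
   Context: For a commutative ring $K$, $K\langle z_1,\ldots,z_d\rangle$ is the ring of non-commutative polynomials: the free $K$-module with basis all words in the letters $z_1,\ldots,z_d$ (order of letters matters), with multiplication extending concatenation of words, the empty word being $1$. The degree $\deg(p)$ is the maximal length of a word appearing in $p$ with nonzero coefficient (with $\deg(0):=0$). Evaluation $p(A_1,\ldots,A_d)$ at square matrices of equal size substitutes $A_j$ for $z_j$, the empty word being sent to the identity matrix. $\mathrm{Mat}_\ell(S)$ denotes the $\ell\times\ell$ matrices with entries in $S$. Define $$\mathcal{P}_{\mathrm{coeff}}=\{p\in\mathbb{Z}\langle z_1,\ldots,z_d\rangle\mid \text{all coefficients of } p \text{ are nonnegative}\},$$ $$\mathcal{P}_{\mathrm{eval}}=\{p\in\mathbb{Z}\langle z_1,\ldots,z_d\rangle\mid \forall \ell\ \forall A_1,\ldots,A_d\in\mathrm{Mat}_\ell(\mathbb{Z}_{\geqslant 0})\colon p(A_1,\ldots,A_d)\in\mathrm{Mat}_\ell(\mathbb{Z}_{\geqslant 0})\}.$$ *)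

theory Defs
  imports
    Complex_Main
    "HOL-Library.Poly_Mapping"
    "HOL-Library.Nonpos_Ints"
    "Jordan_Normal_Form.Matrix"
begin

text \<open>
  The free monoid on a set of letters. Finitely supported maps multiply by convolution in
  HOL-Library as soon as their index type is in class \<open>monoid_add\<close>, which does not require
  commutativity; so concatenation is written \<open>+\<close> here and the empty word is \<open>0\<close>.
\<close>

datatype 'x fword = FWord (letters: "'x list")

instantiation fword :: (type) monoid_add
begin

definition zero_fword :: "'a fword" where
  "0 = FWord []"

definition plus_fword :: "'a fword \<Rightarrow> 'a fword \<Rightarrow> 'a fword" where
  "u + v = FWord (letters u @ letters v)"

instance
  by standard (simp_all add: zero_fword_def plus_fword_def)

end

lemma letters_zero [simp]: "letters 0 = []"
  by (simp add: zero_fword_def)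

lemma letters_plus [simp]: "letters (u + v) = letters u @ letters v"
  by (simp add: plus_fword_def)

text \<open>
  The type \<open>'k ncpoly\<close> has countably many letters, indexed by \<open>nat\<close>; the polynomials in
  \<open>z\<^sub>1, \<dots>, z\<^sub>d\<close> are those in which only letters from \<open>{1..d}\<close> occur.
\<close>

type_synonym 'k ncpoly = "nat fword \<Rightarrow>\<^sub>0 'k"

definition ncpolys :: "nat \<Rightarrow> 'k::comm_ring_1 ncpoly set" where
  "ncpolys d = {p. \<forall>w\<in>Poly_Mapping.keys p. set (letters w) \<subseteq> {1..d}}"

definition nc_var :: "nat \<Rightarrow> 'k::comm_ring_1 ncpoly" where
  "nc_var j = Poly_Mapping.single (FWord [j]) 1"

definition nc_degree :: "'k::comm_ring_1 ncpoly \<Rightarrow> nat" where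
  "nc_degree p =
     (if p = 0 then 0 else Max ((\<lambda>w. length (letters w)) ` Poly_Mapping.keys p))"

definition word_eval ::
    "nat \<Rightarrow> (nat \<Rightarrow> 'k::comm_ring_1 mat) \<Rightarrow> nat fword \<Rightarrow> 'k mat" where
  "word_eval l A w = foldr (\<lambda>j M. A j * M) (letters w) (1\<^sub>m l)"

text \<open>
  The linear combination of the word values is taken entrywise, since matrices of a fixed
  dimension do not form a type and the big sum operator is not available for them.
\<close>

definition nc_eval ::
    "nat \<Rightarrow> 'k::comm_ring_1 ncpoly \<Rightarrow> (nat \<Rightarrow> 'k mat) \<Rightarrow> 'k mat" where
  "nc_eval l p A =
     mat l l (\<lambda>ij. \<Sum>w\<in>Poly_Mapping.keys p. Poly_Mapping.lookup p w * word_eval l A w $$ ij)"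

definition Mats :: "nat \<Rightarrow> 'k set \<Rightarrow> 'k mat set" where
  "Mats l S = {M \<in> carrier_mat l l. elements_mat M \<subseteq> S}"

definition P_coeff :: "nat \<Rightarrow> int ncpoly set" where
  "P_coeff d = {p \<in> ncpolys d. \<forall>w. 0 \<le> Poly_Mapping.lookup p w}"

definition P_eval :: "nat \<Rightarrow> int ncpoly set" where
  "P_eval d = {p \<in> ncpolys d.
     \<forall>l A. (\<forall>j\<in>{1..d}. A j \<in> Mats l {0..}) \<longrightarrow> nc_eval l p A \<in> Mats l {0..}}"


text \<open>
  Evaluation at \<open>l \<times> l\<close> matrices is the unital ring homomorphism sending the letters to the
  given matrices.
\<close>

lemma word_eval_carrier:
  assumes "\<forall>j\<in>set (letters w). A j \<in> carrier_mat l l"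
  shows "word_eval l A w \<in> carrier_mat l l"
proof -
  have "foldr (\<lambda>j M. A j * M) xs (1\<^sub>m l) \<in> carrier_mat l l"
    if "\<forall>j\<in>set xs. A j \<in> carrier_mat l l" for xs
    using that by (induction xs) auto
  with assms show ?thesis by (simp add: word_eval_def)
qed

lemma word_eval_plus:
  assumes "\<forall>j\<in>set (letters u) \<union> set (letters v). A j \<in> carrier_mat l l"
  shows "word_eval l A (u + v) = word_eval l A u * word_eval l A v"
proof -
  have cv: "word_eval l A v \<in> carrier_mat l l"
    using assms by (intro word_eval_carrier) auto
  have "foldr (\<lambda>j M. A j * M) xs (word_eval l A v)
          = foldr (\<lambda>j M. A j * M) xs (1\<^sub>m l) * word_eval l A v
        \<and> foldr (\<lambda>j M. A j * M) xs (1\<^sub>m l) \<in> carrier_mat l l"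
    if "\<forall>j\<in>set xs. A j \<in> carrier_mat l l" for xs
    using that cv by (induction xs) auto
  with assms show ?thesis by (simp add: word_eval_def)
qed

lemma nc_eval_one: "nc_eval l 1 A = 1\<^sub>m l"
  by (rule eq_matI) (auto simp: nc_eval_def word_eval_def lookup_one)

lemma nc_eval_var:
  assumes "A j \<in> carrier_mat l l"
  shows "nc_eval l (nc_var j) A = A j"
  using assms by (intro eq_matI) (auto simp: nc_eval_def nc_var_def word_eval_def)

lemma nc_eval_superset:
  assumes "finite S" "Poly_Mapping.keys p \<subseteq> S"
  shows "nc_eval l p A =
    mat l l (\<lambda>ij. \<Sum>w\<in>S. Poly_Mapping.lookup p w * word_eval l A w $$ ij)"
proof -
  have "(\<Sum>w\<in>Poly_Mapping.keys p. Poly_Mapping.lookup p w * word_eval l A w $$ ij)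
      = (\<Sum>w\<in>S. Poly_Mapping.lookup p w * word_eval l A w $$ ij)" for ij
    using assms by (intro sum.mono_neutral_left) (auto simp: in_keys_iff)
  then show ?thesis by (simp add: nc_eval_def)
qed

lemma nc_eval_add: "nc_eval l (p + q) A = nc_eval l p A + nc_eval l q A"
proof -
  let ?S = "Poly_Mapping.keys p \<union> Poly_Mapping.keys q"
  have "finite ?S" "Poly_Mapping.keys (p + q) \<subseteq> ?S"
    using Poly_Mapping.keys_add[of p q] by auto
  then show ?thesis
    by (intro eq_matI)
      (auto simp: nc_eval_superset[of ?S] lookup_add sum.distrib distrib_right)
qed

lemma nc_eval_smult: "nc_eval l (Poly_Mapping.single 0 c * p) A = c \<cdot>\<^sub>m nc_eval l p A"
proof -
  have eq: "Poly_Mapping.single 0 c * p = Poly_Mapping.map ((*) c) p"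
    by (simp add: mult_map_scale_conv_mult)
  have lk: "Poly_Mapping.lookup (Poly_Mapping.map ((*) c) p) w = c * Poly_Mapping.lookup p w"
    for w by (simp add: Poly_Mapping.map.rep_eq when_def)
  have "Poly_Mapping.keys (Poly_Mapping.map ((*) c) p) \<subseteq> Poly_Mapping.keys p"
    by (auto simp: in_keys_iff lk)
  then show ?thesis
    by (intro eq_matI)
      (auto simp: eq nc_eval_superset[of "Poly_Mapping.keys p"] lk nc_eval_def[of l p]
        sum_distrib_left mult.assoc)
qed

lemma nc_eval_single:
  "nc_eval l (Poly_Mapping.single w c) A = mat l l (\<lambda>ij. c * word_eval l A w $$ ij)"
  by (auto simp: nc_eval_superset[of "{w}"])

lemma ncpolys_induct [consumes 1, case_names zero add]:
  assumes "p \<in> ncpolys d"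
    and zero: "P 0"
    and add: "\<And>w c q. \<lbrakk>set (letters w) \<subseteq> {1..d}; q \<in> ncpolys d; P q\<rbrakk>
      \<Longrightarrow> P (Poly_Mapping.single w c + q)"
  shows "P p"
  using assms(1)
proof (induction "card (Poly_Mapping.keys p)" arbitrary: p)
  case 0
  then have "p = 0" by simp
  with zero show ?case by simp
next
  case (Suc n)
  then obtain w where w: "w \<in> Poly_Mapping.keys p"
    by (metis card.empty ex_in_conv nat.distinct(1))
  define q where "q = p - Poly_Mapping.single w (Poly_Mapping.lookup p w)"
  have k: "Poly_Mapping.keys q = Poly_Mapping.keys p - {w}"
    by (auto simp: q_def in_keys_iff lookup_minus lookup_single when_def split: if_splits)
  have "n = card (Poly_Mapping.keys q)"
    using Suc.hyps(2) w by (simp add: k)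
  moreover have "q \<in> ncpolys d" "set (letters w) \<subseteq> {1..d}"
    using Suc.prems w by (auto simp: ncpolys_def k)
  ultimately have "P (Poly_Mapping.single w (Poly_Mapping.lookup p w) + q)"
    using Suc.hyps(1) add by blast
  then show ?case by (simp add: q_def)
qed

lemma nc_eval_mult:
  assumes p: "p \<in> ncpolys d" and q: "q \<in> ncpolys d"
    and A: "\<forall>j\<in>{1..d}. A j \<in> carrier_mat l l"
  shows "nc_eval l (p * q) A = nc_eval l p A * nc_eval l q A"
proof -
  have c [simp]: "nc_eval l r A \<in> carrier_mat l l" for r
    by (simp add: nc_eval_def)
  have z: "nc_eval l 0 A = 0\<^sub>m l l"
    by (rule eq_matI) (auto simp: nc_eval_def)
  have wc: "word_eval l A w \<in> carrier_mat l l" if "set (letters w) \<subseteq> {1..d}" for w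
    using that A by (intro word_eval_carrier) auto
  have s: "nc_eval l (Poly_Mapping.single w a) A = a \<cdot>\<^sub>m word_eval l A w"
    if "set (letters w) \<subseteq> {1..d}" for w a
    using wc[OF that] by (intro eq_matI) (auto simp: nc_eval_single)
  have ss: "nc_eval l (Poly_Mapping.single u a * Poly_Mapping.single v b) A
      = nc_eval l (Poly_Mapping.single u a) A * nc_eval l (Poly_Mapping.single v b) A"
    if u: "set (letters u) \<subseteq> {1..d}" and v: "set (letters v) \<subseteq> {1..d}" for u v a b
  proof -
    have "word_eval l A (u + v) = word_eval l A u * word_eval l A v"
      using u v A by (intro word_eval_plus) auto
    moreover have "set (letters (u + v)) \<subseteq> {1..d}" using u v by auto
    ultimately show ?thesis
      using wc[OF u] wc[OF v] u v
      by (simp add: mult_single s mult_smult_distrib[of _ l l _ l] mult_smult_assoc_mat[of _ l l _ l])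
        (rule eq_matI, auto simp: algebra_simps)
  qed
  have sq: "nc_eval l (Poly_Mapping.single u a * q) A
      = nc_eval l (Poly_Mapping.single u a) A * nc_eval l q A"
    if u: "set (letters u) \<subseteq> {1..d}" for u a
    using q
  proof (induction rule: ncpolys_induct)
    case zero
    show ?case using right_mult_zero_mat[OF c] by (simp add: z)
  next
    case (add w b r)
    then show ?case
      using mult_add_distrib_mat[OF c c c] by (simp add: distrib_left nc_eval_add ss[OF u])
  qed
  show ?thesis
    using p
  proof (induction rule: ncpolys_induct)
    case zero
    show ?case using left_mult_zero_mat[OF c] by (simp add: z)
  next
    case (add w b r)
    then show ?case
      using add_mult_distrib_mat[OF c c c] by (simp add: distrib_right nc_eval_add sq)
  qed
qed

end

theory Submission
  imports Defs
begin

text \<open>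
  Nonnegative coefficients trivially give nonnegative values. The converse holds because every
  single coefficient is an entry of a suitable value. Given a word \<open>w\<close> of length \<open>k\<close>, consider
  the directed path with vertices \<open>0, \<dots>, k\<close> whose \<open>r\<close>-th edge, from \<open>r\<close> to \<open>r + 1\<close>, carries the
  \<open>r\<close>-th letter of \<open>w\<close>, and let \<open>A\<^sub>j\<close> be the adjacency matrix of the edges with label \<open>j\<close>. The
  entry of a word \<open>v\<close> at position \<open>(0, k)\<close> counts the walks from \<open>0\<close> to \<open>k\<close> that spell \<open>v\<close>; the
  only walk between these vertices spells \<open>w\<close>, so that the entry of \<open>p(A)\<close> at \<open>(0, k)\<close> is
  exactly the coefficient of \<open>w\<close> in \<open>p\<close> (\<open>nc_eval_path_mat\<close>). If \<open>w\<close> occurs in \<open>p\<close>, the path has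
  at most \<open>deg(p) + 1\<close> vertices, which explains the matrix size.

  Positivity enters through the closure of the nonnegative elements under addition and
  multiplication. The equivalence is therefore proved for a subsemiring \<open>S\<close> of a commutative
  ring and matrix entries from any \<open>T \<subseteq> S\<close> containing \<open>0\<close> and \<open>1\<close>
  (\<open>coeffs_in_iff_nc_eval_in\<close>). The complex case takes \<open>T = \<nat>\<close> inside the nonnegative reals, the
  integral one \<open>S = T = {0..}\<close>.
\<close>

lemma Mats_iff:
  "M \<in> Mats l S \<longleftrightarrow> M \<in> carrier_mat l l \<and> (\<forall>i<l. \<forall>j<l. M $$ (i, j) \<in> S)"
  unfolding Mats_def by fastforce

lemma word_eval_in_Mats:
  fixes S :: "'k::comm_ring_1 set"
  assumes S: "0 \<in> S" "1 \<in> S"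
      "\<And>a b. a \<in> S \<Longrightarrow> b \<in> S \<Longrightarrow> a + b \<in> S" "\<And>a b. a \<in> S \<Longrightarrow> b \<in> S \<Longrightarrow> a * b \<in> S"
    and A: "\<forall>j\<in>set (letters w). A j \<in> Mats l S"
  shows "word_eval l A w \<in> Mats l S"
proof -
  have "foldr (\<lambda>j M. A j * M) xs (1\<^sub>m l) \<in> Mats l S" if "\<forall>j\<in>set xs. A j \<in> Mats l S" for xs
    using that
  proof (induction xs)
    case Nil
    then show ?case using S by (auto simp: Mats_iff)
  next
    case (Cons x xs)
    have sum_in: "sum f B \<in> S" if "\<And>b. b \<in> B \<Longrightarrow> f b \<in> S" for f and B :: "nat set"
      using that by (induction B rule: infinite_finite_induct) (auto intro: S)
    from Cons have x: "A x \<in> Mats l S" and xs: "foldr (\<lambda>j M. A j * M) xs (1\<^sub>m l) \<in> Mats l S"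
      by auto
    then show ?case
      by (auto simp: Mats_iff scalar_prod_def intro!: sum_in S)
  qed
  with A show ?thesis by (simp add: word_eval_def)
qed

lemma nc_eval_in_Mats:
  fixes S :: "'k::comm_ring_1 set"
  assumes S: "0 \<in> S" "1 \<in> S"
      "\<And>a b. a \<in> S \<Longrightarrow> b \<in> S \<Longrightarrow> a + b \<in> S" "\<And>a b. a \<in> S \<Longrightarrow> b \<in> S \<Longrightarrow> a * b \<in> S"
    and p: "p \<in> ncpolys d" "\<And>w. Poly_Mapping.lookup p w \<in> S"
    and A: "\<forall>j\<in>{1..d}. A j \<in> Mats l S"
  shows "nc_eval l p A \<in> Mats l S"
proof -
  have sum_in: "sum f B \<in> S" if "\<And>b. b \<in> B \<Longrightarrow> f b \<in> S" for f and B :: "nat fword set"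
    using that by (induction B rule: infinite_finite_induct) (auto intro: S)
  have "word_eval l A w \<in> Mats l S" if "w \<in> Poly_Mapping.keys p" for w
    using that p(1) A by (intro word_eval_in_Mats S) (auto simp: ncpolys_def)
  then show ?thesis
    by (auto simp: Mats_iff nc_eval_def intro!: sum_in S p(2))
qed

text \<open>
  The adjacency matrix of the edges labelled \<open>j\<close> in the path that spells \<open>xs\<close>; vertices from
  \<open>n\<close> on are cut off, and those beyond the end of the path are isolated.
\<close>

definition path_mat :: "nat \<Rightarrow> nat list \<Rightarrow> nat \<Rightarrow> 'k::comm_ring_1 mat" where
  "path_mat n xs j = mat n n (\<lambda>(r, s). of_bool (s = Suc r \<and> r < length xs \<and> xs ! r = j))"

text \<open>
  All edges lead from a vertex to its successor, so there is at most one walk from \<open>i\<close> to \<open>s\<close>,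
  and it spells the segment of \<open>xs\<close> between these positions. The general start vertex \<open>i\<close>
  is what the induction over \<open>ys\<close> requires: removing the first letter of \<open>ys\<close> moves the start
  one step along the path. For \<open>i = s\<close> only the empty walk remains, and it exists at the isolated
  vertices beyond the end of the path as well; hence the bound on \<open>s\<close> is required for \<open>i < s\<close> only.
\<close>

lemma foldr_path_mat:
  fixes ys :: "nat list"
  assumes "i < n" "s < n"
  shows "foldr (\<lambda>j M. path_mat n xs j * M) ys (1\<^sub>m n) $$ (i, s)
    = (of_bool (i \<le> s \<and> (i < s \<longrightarrow> s \<le> length xs) \<and> ys = drop i (take s xs)) :: 'k::comm_ring_1)"
  using assms(1)
proof (induction ys arbitrary: i)
  case Nil
  then show ?case using assms(2) by auto
next
  case (Cons y ys)
  let ?F = "foldr (\<lambda>j M. path_mat n xs j * M) ys (1\<^sub>m n) :: 'k mat"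
  have F: "?F \<in> carrier_mat n n"
    by (induction ys) (auto simp: path_mat_def)
  have "(path_mat n xs y * ?F) $$ (i, s)
      = (\<Sum>r<n. of_bool (r = Suc i \<and> i < length xs \<and> xs ! i = y) * ?F $$ (r, s))"
    using F Cons.prems assms(2)
    by (auto simp: path_mat_def scalar_prod_def lessThan_atLeast0 intro!: sum.cong)
  also have "\<dots> = (\<Sum>r<n. if r = Suc i then of_bool (i < length xs \<and> xs ! i = y) * ?F $$ (r, s) else 0)"
    by (intro sum.cong) auto
  also have "\<dots> = of_bool (Suc i < n \<and> i < length xs \<and> xs ! i = y) * ?F $$ (Suc i, s)"
    by (simp add: sum.delta)
  also have "\<dots> = of_bool (i \<le> s \<and> (i < s \<longrightarrow> s \<le> length xs) \<and> y # ys = drop i (take s xs))"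
  proof (cases "i < s \<and> s \<le> length xs")
    case True
    then have "drop i (take s xs) = xs ! i # drop (Suc i) (take s xs)"
      by (subst Cons_nth_drop_Suc [symmetric]) auto
    then show ?thesis using True assms(2) Cons.IH[of "Suc i"] by auto
  next
    case False
    then show ?thesis using Cons.IH[of "Suc i"] by (cases "Suc i < n") auto
  qed
  finally show ?case by simp
qed

text \<open>
  The edge matrices of the path that spells \<open>w\<close> isolate the coefficient of \<open>w\<close>: no other word
  leads from the first to the last vertex.
\<close>

lemma nc_eval_path_mat:
  fixes p :: "'k::comm_ring_1 ncpoly"
  assumes "length (letters w) < n"
  shows "nc_eval n p (path_mat n (letters w)) $$ (0, length (letters w)) = Poly_Mapping.lookup p w"
proof -
  have "word_eval n (path_mat n (letters w)) v $$ (0, length (letters w)) = (of_bool (v = w) :: 'k)"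
    for v
    using assms by (auto simp: word_eval_def foldr_path_mat fword.expand)
  then have "nc_eval n p (path_mat n (letters w)) $$ (0, length (letters w))
      = (\<Sum>v\<in>Poly_Mapping.keys p. if v = w then Poly_Mapping.lookup p v else 0)"
    using assms by (auto simp: nc_eval_def intro!: sum.cong)
  then show ?thesis by (auto simp: sum.delta in_keys_iff)
qed

lemma length_le_nc_degree:
  assumes "w \<in> Poly_Mapping.keys p"
  shows "length (letters w) \<le> nc_degree p"
  using assms by (auto simp: nc_degree_def)

text \<open>
  The elements of \<open>S\<close> serve as the nonnegative ones. The test matrices need only the entries \<open>0\<close>
  and \<open>1\<close>, so the set \<open>T\<close> of permitted entries may be anything between \<open>{0, 1}\<close> and \<open>S\<close>.
\<close>

theorem coeffs_in_iff_nc_eval_in: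
  fixes S T :: "'k::comm_ring_1 set"
  assumes T: "0 \<in> T" "1 \<in> T" "T \<subseteq> S"
    and S: "\<And>a b. a \<in> S \<Longrightarrow> b \<in> S \<Longrightarrow> a + b \<in> S" "\<And>a b. a \<in> S \<Longrightarrow> b \<in> S \<Longrightarrow> a * b \<in> S"
    and p: "p \<in> ncpolys d" "nc_degree p < l"
  shows "(\<forall>w. Poly_Mapping.lookup p w \<in> S) \<longleftrightarrow>
    (\<forall>A. (\<forall>j\<in>{1..d}. A j \<in> Mats l T) \<longrightarrow> nc_eval l p A \<in> Mats l S)"
proof (intro iffI allI impI)
  fix A assume "\<forall>w. Poly_Mapping.lookup p w \<in> S" "\<forall>j\<in>{1..d}. A j \<in> Mats l T"
  moreover from this(2) have "\<forall>j\<in>{1..d}. A j \<in> Mats l S"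
    using T(3) by (auto simp: Mats_def)
  ultimately show "nc_eval l p A \<in> Mats l S"
    using T S p(1) by (intro nc_eval_in_Mats) auto
next
  fix w
  assume eval: "\<forall>A. (\<forall>j\<in>{1..d}. A j \<in> Mats l T) \<longrightarrow> nc_eval l p A \<in> Mats l S"
  show "Poly_Mapping.lookup p w \<in> S"
  proof (cases "w \<in> Poly_Mapping.keys p")
    case True
    then have len: "length (letters w) < l"
      using length_le_nc_degree p(2) le_less_trans by blast
    have "path_mat l (letters w) j \<in> Mats l T" for j
      using T by (auto simp: Mats_iff path_mat_def)
    then have "nc_eval l p (path_mat l (letters w)) $$ (0, length (letters w)) \<in> S"
      using eval len by (auto simp: Mats_iff)
    then show ?thesis using len by (simp add: nc_eval_path_mat)
  next
    case False
    then show ?thesis using T by (auto simp: in_keys_iff)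
  qed
qed

theorem theorem21:
  fixes d :: nat
  shows
    "(\<forall>p :: complex ncpoly. p \<in> ncpolys d \<longrightarrow>
        ((\<forall>w. Poly_Mapping.lookup p w \<in> \<real>\<^sub>\<ge>\<^sub>0) \<longleftrightarrow>
         (\<forall>A. (\<forall>j\<in>{1..d}. A j \<in> Mats (nc_degree p + 1) \<nat>) \<longrightarrow>
              nc_eval (nc_degree p + 1) p A \<in> Mats (nc_degree p + 1) \<real>\<^sub>\<ge>\<^sub>0)))
     \<and> P_coeff d = P_eval d
     \<and> (\<forall>p :: int ncpoly. p \<in> ncpolys d \<longrightarrow>
          (p \<in> P_eval d \<longleftrightarrow>
           (\<forall>A. (\<forall>j\<in>{1..d}. A j \<in> Mats (nc_degree p + 1) {0..}) \<longrightarrow>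
                nc_eval (nc_degree p + 1) p A \<in> Mats (nc_degree p + 1) {0..})))"
proof -
  have complex_case: "(\<forall>w. Poly_Mapping.lookup p w \<in> \<real>\<^sub>\<ge>\<^sub>0) \<longleftrightarrow>
      (\<forall>A. (\<forall>j\<in>{1..d}. A j \<in> Mats (nc_degree p + 1) \<nat>) \<longrightarrow>
        nc_eval (nc_degree p + 1) p A \<in> Mats (nc_degree p + 1) \<real>\<^sub>\<ge>\<^sub>0)"
    if "p \<in> ncpolys d" for p :: "complex ncpoly"
    using that by (intro coeffs_in_iff_nc_eval_in) (auto simp: Nats_def)
  have int_case: "(\<forall>w. 0 \<le> Poly_Mapping.lookup p w) \<longleftrightarrow>
      (\<forall>A. (\<forall>j\<in>{1..d}. A j \<in> Mats l {0..}) \<longrightarrow> nc_eval l p A \<in> Mats l {0..})"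
    if "p \<in> ncpolys d" "nc_degree p < l" for p :: "int ncpoly" and l
    using coeffs_in_iff_nc_eval_in[of "{0..}" "{0..}" p d l] that by simp
  have int_eval: "nc_eval l p A \<in> Mats l {0..}"
    if "p \<in> P_coeff d" "\<forall>j\<in>{1..d}. A j \<in> Mats l {0..}" for p A l
    using that by (intro nc_eval_in_Mats[of _ _ d]) (auto simp: P_coeff_def)
  have "p \<in> P_coeff d \<longleftrightarrow> p \<in> P_eval d" for p
    using int_eval[of p] int_case[of p "nc_degree p + 1"]
    by (auto simp: P_coeff_def P_eval_def)
  then have eq: "P_coeff d = P_eval d" by blast
  have "p \<in> P_eval d \<longleftrightarrow>
      (\<forall>A. (\<forall>j\<in>{1..d}. A j \<in> Mats (nc_degree p + 1) {0..}) \<longrightarrow>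
        nc_eval (nc_degree p + 1) p A \<in> Mats (nc_degree p + 1) {0..})"
    if "p \<in> ncpolys d" for p
    using int_case[OF that, of "nc_degree p + 1"] that
    unfolding eq[symmetric] P_coeff_def by auto
  with complex_case eq show ?thesis by blast
qed

end
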